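(* Let $\mathcal{U}\subset\mathbb{C}$ be open, let $h$ be holomorphic on $\mathcal{U}$, let $\mathcal{H}_{\mathbb C}=\{(z,\mathfrak{X})\in\mathcal{U}\times(\mathbb{C}\setminus\{0\}) : \mathfrak{X}^2\neq h(z)\}$, and let $$G_h=\frac{\left(h(z)-\mathfrak{X}^2\right)^2dz^2+d\mathfrak{X}^2}{\mathfrak{X}^2}.$$ The holomorphic metric $G_h$ has, in the whole domain $\mathcal{H}_{\mathbb C}$, constant holomorphic sectional curvature equal to $-1$. Therefore, it is locally holomorphically isometric to a complex $2$-sphere of (complex) radius equal to the imaginary unit $i$.
   Context: A complex (holomorphic) Riemannian manifold $(\mathcal M,G)$ is a complex manifold $\mathcal M$ of complex dimension $N$ with a holomorphic metric $G$: in local holomorphic coordinates $(Z^1,\dots,Z^N)$, $G=G_{ab}\,dZ^a dZ^b$ with $G_{ab}$ symmetric, non-degenerate and holomorphic (not depending on $\bar Z^a$). The unique symmetric holomorphic metric connection has Christoffel symbols $\Upsilon^i_{jk}$ given by the usual formula, and the holomorphic curvature tensor is given by the usual formula $R^i{}_{jkl}=\Upsilon^i_{jl,k}-\Upsilon^i_{jk,l}+\Upsilon^i_{mk}\Upsilon^m_{jl}-\Upsilon^i_{ml}\Upsilon^m_{jk}$; in complex dimension two the holomorphic sectional curvature is $R_{1212}/(G_{11}G_{22}-G_{12}^2)$. The complex $N$-sphere of radius $r\in\mathbb{C}\setminus\{0\}$ is the holomorphic hypersurface $(Z^1)^2+\dots+(Z^{N+1})^2=r^2$ of the complex Euclidean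 space $\mathbb{C}^{N+1}$ with metric $\sum_a (dZ^a)^2$, equipped with the induced holomorphic metric. A local holomorphic isometry is a local biholomorphism pulling back one holomorphic metric to the other. *)

theory Defs
  imports "HOL-Analysis.Analysis"
begin

text \<open>
  Holomorphy in several complex variables: complex Frechet differentiability at every point
  of an open set, i.e. the (real) Frechet derivative is given by a complex covector.
\<close>
definition holo_fun_on :: "(complex ^ 'm \<Rightarrow> complex) \<Rightarrow> (complex ^ 'm) set \<Rightarrow> bool" where
  "holo_fun_on f S \<longleftrightarrow> open S \<and>
     (\<forall>x\<in>S. \<exists>a :: complex ^ 'm. (f has_derivative (\<lambda>v. \<Sum>i\<in>UNIV. a $ i * v $ i)) (at x))"

definition holo_map_on :: "(complex ^ 'm \<Rightarrow> complex ^ 'n) \<Rightarrow> (complex ^ 'm) set \<Rightarrow> bool" where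
  "holo_map_on F S \<longleftrightarrow> (\<forall>a. holo_fun_on (\<lambda>x. F x $ a) S)"

text \<open>
  Holomorphy of a map defined on a relatively open part \<open>V\<close> of an embedded complex submanifold of
  \<open>\<complex>\<^sup>n\<close>: locally it is the restriction of a holomorphic map on an open subset of \<open>\<complex>\<^sup>n\<close>.
\<close>
definition holo_map_on_sub :: "(complex ^ 'n \<Rightarrow> complex ^ 'm) \<Rightarrow> (complex ^ 'n) set \<Rightarrow> bool" where
  "holo_map_on_sub F V \<longleftrightarrow>
     (\<forall>q\<in>V. \<exists>W F'. q \<in> W \<and> holo_map_on F' W \<and> (\<forall>y\<in>W \<inter> V. F y = F' y))"

definition partial_deriv :: "'n \<Rightarrow> (complex ^ 'n \<Rightarrow> complex) \<Rightarrow> complex ^ 'n \<Rightarrow> complex" where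
  "partial_deriv k f x = deriv (\<lambda>t. f (x + axis k t)) 0"

definition jacobian_matrix ::
    "(complex ^ 'm \<Rightarrow> complex ^ 'n) \<Rightarrow> complex ^ 'm \<Rightarrow> complex ^ 'm ^ 'n" where
  "jacobian_matrix F x = (\<chi> a i. partial_deriv i (\<lambda>y. F y $ a) x)"

text \<open>A metric in coordinates is represented by its component matrix \<open>G x $ a $ b\<close>.\<close>

type_synonym 'n metric = "complex ^ 'n \<Rightarrow> complex ^ 'n ^ 'n"

definition holo_metric_on :: "(complex ^ 'n) set \<Rightarrow> 'n::finite metric \<Rightarrow> bool" where
  "holo_metric_on M G \<longleftrightarrow>
     (\<forall>a b. holo_fun_on (\<lambda>x. G x $ a $ b) M) \<and>
     (\<forall>x\<in>M. transpose (G x) = G x \<and> det (G x) \<noteq> 0)"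

definition christoffel :: "'n::finite metric \<Rightarrow> 'n \<Rightarrow> 'n \<Rightarrow> 'n \<Rightarrow> complex ^ 'n \<Rightarrow> complex" where
  "christoffel G i j k x =
     (\<Sum>l\<in>UNIV. matrix_inv (G x) $ i $ l *
        (partial_deriv k (\<lambda>y. G y $ l $ j) x + partial_deriv j (\<lambda>y. G y $ l $ k) x
          - partial_deriv l (\<lambda>y. G y $ j $ k) x)) / 2"

text \<open>\<open>curvature G i j k l\<close> is \<open>R\<^sup>i\<^sub>j\<^sub>k\<^sub>l\<close>, \<open>curvature_low G i j k l\<close> is \<open>R\<^sub>i\<^sub>j\<^sub>k\<^sub>l\<close>.\<close>

definition curvature ::
    "'n::finite metric \<Rightarrow> 'n \<Rightarrow> 'n \<Rightarrow> 'n \<Rightarrow> 'n \<Rightarrow> complex ^ 'n \<Rightarrow> complex" where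
  "curvature G i j k l x =
     partial_deriv k (christoffel G i j l) x - partial_deriv l (christoffel G i j k) x
     + (\<Sum>m\<in>UNIV. christoffel G i m k x * christoffel G m j l x)
     - (\<Sum>m\<in>UNIV. christoffel G i m l x * christoffel G m j k x)"

definition curvature_low ::
    "'n::finite metric \<Rightarrow> 'n \<Rightarrow> 'n \<Rightarrow> 'n \<Rightarrow> 'n \<Rightarrow> complex ^ 'n \<Rightarrow> complex" where
  "curvature_low G i j k l x = (\<Sum>m\<in>UNIV. G x $ i $ m * curvature G m j k l x)"

definition sectional_curvature :: "2 metric \<Rightarrow> complex ^ 2 \<Rightarrow> complex" where
  "sectional_curvature G x =
     curvature_low G 1 2 1 2 x / (G x $ 1 $ 1 * G x $ 2 $ 2 - (G x $ 1 $ 2)\<^sup>2)"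

definition flat_metric :: "'n::finite metric" where
  "flat_metric = (\<lambda>_. mat 1)"

definition pullback_metric ::
    "(complex ^ 'm::finite \<Rightarrow> complex ^ 'n::finite) \<Rightarrow> 'n metric \<Rightarrow> 'm metric" where
  "pullback_metric F E x =
     transpose (jacobian_matrix F x) ** E (F x) ** jacobian_matrix F x"

text \<open>The complex sphere of radius \<open>r\<close>; its dimension is \<open>CARD('n) - 1\<close>.\<close>
definition complex_sphere :: "complex \<Rightarrow> (complex ^ 'n::finite) set" where
  "complex_sphere r = {Z. (\<Sum>a\<in>UNIV. (Z $ a)\<^sup>2) = r\<^sup>2}"

text \<open>
  \<open>(M, G)\<close>, with \<open>M\<close> open in \<open>\<complex>\<^sup>m\<close>, is locally isometric to the complex submanifold \<open>S\<close> of \<open>\<complex>\<^sup>n\<close>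
  with the metric induced by the ambient metric \<open>E\<close>: every point of \<open>M\<close> has an open neighbourhood
  \<open>U\<close> with a biholomorphism \<open>F\<close> (with inverse \<open>F'\<close>) onto a relatively open subset \<open>V\<close> of \<open>S\<close> that
  pulls the metric back to \<open>G\<close>. Since \<open>F\<close> takes values in \<open>S\<close>, its differential takes values in
  the tangent spaces of \<open>S\<close>, so pulling back \<open>E\<close> is the same as pulling back the induced metric.
\<close>
definition locally_holo_isometric ::
    "(complex ^ 'm::finite) set \<Rightarrow> 'm metric \<Rightarrow> (complex ^ 'n::finite) set \<Rightarrow> 'n metric \<Rightarrow> bool"
  where
  "locally_holo_isometric M G S E \<longleftrightarrow>
     (\<forall>p\<in>M. \<exists>U V F F'.
        open U \<and> p \<in> U \<and> U \<subseteq> M \<and> openin (top_of_set S) V \<and>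
        holo_map_on F U \<and> holo_map_on_sub F' V \<and>
        (\<forall>x\<in>U. F x \<in> V \<and> F' (F x) = x) \<and> (\<forall>y\<in>V. F' y \<in> U \<and> F (F' y) = y) \<and>
        (\<forall>x\<in>U. pullback_metric F E x = G x))"

text \<open>Coordinates on \<open>\<complex>\<^sup>2\<close>: \<open>Z $ 1\<close> is \<open>z\<close> and \<open>Z $ 2\<close> is \<open>\<XX>\<close>.\<close>

definition H_dom :: "complex set \<Rightarrow> (complex \<Rightarrow> complex) \<Rightarrow> (complex ^ 2) set" where
  "H_dom \<U> h = {Z. Z $ 1 \<in> \<U> \<and> Z $ 2 \<noteq> 0 \<and> (Z $ 2)\<^sup>2 \<noteq> h (Z $ 1)}"

definition G_metric :: "(complex \<Rightarrow> complex) \<Rightarrow> 2 metric" where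
  "G_metric h Z =
     vector [vector [(h (Z $ 1) - (Z $ 2)\<^sup>2)\<^sup>2 / (Z $ 2)\<^sup>2, 0],
             vector [0, 1 / (Z $ 2)\<^sup>2]]"

end

theory Submission
  imports Defs "HOL-Complex_Analysis.Cauchy_Integral_Formula"
begin

text \<open>
  The null curves of \<open>G\<^sub>h\<close> solve the Riccati equations \<open>d\<XX>/dz = \<plusminus> \<i> (h - \<XX>\<^sup>2)\<close>, which the substitution
  \<open>\<XX> = \<minusplus> \<i> u'/u\<close> linearises to \<open>u'' = - h u\<close>. This suggests an explicit isometry: for solutions
  \<open>u\<close>, \<open>v\<close> of the linear equation with Wronskian \<open>1\<close>, put
  \<open>a = u'\<^sup>2/\<XX> + \<XX> u\<^sup>2\<close>, \<open>b = v'\<^sup>2/\<XX> + \<XX> v\<^sup>2\<close>, \<open>c = u' v'/\<XX> + \<XX> u v\<close>. Then \<open>c\<^sup>2 - a b = -1\<close> and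
  \<open>dc\<^sup>2 - da db = G\<^sub>h\<close>, and \<open>(c, \<i> (a + b)/2, (a - b)/2)\<close> parametrises the sphere of radius \<open>\<i>\<close>.
\<close>

subsection \<open>Local solutions of \<open>u'' = - h u\<close>\<close>

text \<open>Taylor coefficients of the solution of u'' = - h u with u(0) = \<open>a\<close> and
  u'(0) = \<open>b\<close>, where \<open>c\<close> lists the coefficients of h. Comparing
  coefficients of z^n expresses the coefficient of index n + 2 through the earlier ones.\<close>

fun oscillator_coeff :: "(nat \<Rightarrow> complex) \<Rightarrow> complex \<Rightarrow> complex \<Rightarrow> nat \<Rightarrow> complex" where
  "oscillator_coeff c a b 0 = a"
| "oscillator_coeff c a b (Suc 0) = b"
| "oscillator_coeff c a b (Suc (Suc n)) =
     - (\<Sum>k\<le>n. c k * oscillator_coeff c a b (n - k)) / (of_nat (Suc n) * of_nat (Suc (Suc n)))"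

lemma fps_deriv_deriv_oscillator:
  "fps_deriv (fps_deriv (Abs_fps (oscillator_coeff (fps_nth H) a b))) =
     - (H * Abs_fps (oscillator_coeff (fps_nth H) a b))"
proof (rule fps_ext)
  fix n
  have "(of_nat (Suc n) * of_nat (Suc (Suc n)) :: complex) \<noteq> 0"
    by (simp del: of_nat_Suc)
  then show "fps_nth (fps_deriv (fps_deriv (Abs_fps (oscillator_coeff (fps_nth H) a b)))) n =
     fps_nth (- (H * Abs_fps (oscillator_coeff (fps_nth H) a b))) n"
    by (simp add: fps_mult_nth atLeast0AtMost del: of_nat_Suc)
qed

text \<open>The exponent n + 2 in the bound on \<open>c\<close> is what closes the induction: each
  product in the recursion is at most M^(k+2) A M^(m-k) = A M^(m+2), already the bound wanted at
  index m + 2. The m + 1 summands are absorbed by the denominator (m+1)(m+2).\<close>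

lemma norm_oscillator_coeff_le:
  assumes M: "1 \<le> M" and c: "\<And>n. norm (c n) \<le> M ^ (n + 2)"
    and A: "norm a \<le> A" "norm b \<le> A"
  shows "norm (oscillator_coeff c a b n) \<le> A * M ^ n"
proof (induction n rule: less_induct)
  case (less n)
  have A0: "0 \<le> A" using A(1) norm_ge_zero order_trans by blast
  show ?case
  proof (cases "n \<le> 1")
    case True
    then consider "n = 0" | "n = Suc 0" by linarith
    then show ?thesis
    proof cases
      case 2
      have "A * 1 \<le> A * M" using A0 M by (intro mult_left_mono) auto
      then show ?thesis using A 2 by simp
    qed (use A in simp)
  next
    case False
    then obtain m where n: "n = Suc (Suc m)" by (metis One_nat_def not_less_eq_eq not0_implies_Suc le0)
    have "norm (c k * oscillator_coeff c a b (m - k)) \<le> A * M ^ n" if "k \<le> m" for k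
    proof -
      have "norm (c k * oscillator_coeff c a b (m - k)) \<le> M ^ (k + 2) * (A * M ^ (m - k))"
        unfolding norm_mult using less[of "m - k"] n M c[of k] by (intro mult_mono) auto
      also have "\<dots> = A * M ^ n"
        using that by (simp add: n power_add[symmetric] flip: power_Suc)
      finally show ?thesis .
    qed
    then have "norm (\<Sum>k\<le>m. c k * oscillator_coeff c a b (m - k)) \<le> real (Suc m) * (A * M ^ n)"
      using sum_norm_bound[of "{..m}" "\<lambda>k. c k * oscillator_coeff c a b (m - k)" "A * M ^ n"] by simp
    also have "\<dots> \<le> real (Suc m) * (A * M ^ n) * real (Suc (Suc m))"
      using mult_left_mono[of 1 "real (Suc (Suc m))" "real (Suc m) * (A * M ^ n)"] A0 M
      by (simp del: of_nat_Suc)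
    finally show ?thesis
      unfolding n by (simp add: norm_divide norm_mult field_simps del: of_nat_Suc)
  qed
qed

text \<open>At a radius r inside the disc of convergence the terms are bounded by some C, so the
  n-th coefficient is at most C / r^n. A single M above 1, C and 1/r absorbs both factors and yields
  the shape required by the majorant estimate.\<close>

lemma fps_coeff_geometric_bound:
  fixes H :: "complex fps"
  assumes "fps_conv_radius H > 0"
  obtains M where "1 \<le> M" "\<And>n. norm (fps_nth H n) \<le> M ^ (n + 2)"
proof -
  obtain r where r: "0 < ereal r" "ereal r < fps_conv_radius H"
    using ereal_dense2[OF assms] by blast
  then have "summable (\<lambda>n. fps_nth H n * of_real r ^ n)"
    by (intro summable_in_conv_radius) (auto simp: fps_conv_radius_def)
  then have "Bseq (\<lambda>n. fps_nth H n * of_real r ^ n)"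
    by (intro convergent_imp_Bseq summable_LIMSEQ_zero[THEN convergentI])
  then obtain C where C: "C > 0" "\<And>n. norm (fps_nth H n * of_real r ^ n) \<le> C"
    by (auto simp: Bseq_def)
  define M where "M = max 1 (max C (1 / r))"
  have M: "1 \<le> M" "C \<le> M" "1 / r \<le> M" by (auto simp: M_def)
  have "norm (fps_nth H n) \<le> M ^ (n + 2)" for n
  proof -
    have "norm (fps_nth H n) = norm (fps_nth H n * of_real r ^ n) * (1 / r) ^ n"
      using r by (simp add: norm_mult norm_power power_divide)
    also have "\<dots> \<le> C * M ^ n"
      using C M r by (intro mult_mono power_mono) auto
    also have "\<dots> \<le> M ^ 2 * M ^ n"
      using C M self_le_power[of M 2] by (intro mult_right_mono) auto
    finally show ?thesis by (simp add: power2_eq_square mult_ac)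
  qed
  with M show ?thesis using that by blast
qed

lemma fps_conv_radius_oscillator_pos:
  assumes "fps_conv_radius H > 0"
  shows "fps_conv_radius (Abs_fps (oscillator_coeff (fps_nth H) a b)) > 0"
proof -
  obtain M where M: "1 \<le> M" "\<And>n. norm (fps_nth H n) \<le> M ^ (n + 2)"
    using fps_coeff_geometric_bound[OF assms] by blast
  define A where "A = max (norm a) (norm b)"
  have le: "norm (oscillator_coeff (fps_nth H) a b n) \<le> A * M ^ n" for n
    by (rule norm_oscillator_coeff_le[OF M]) (auto simp: A_def)
  \<comment> \<open>Half of the radius 1/M suggested by the majorant, so that the terms are
    dominated by the geometric series A / 2^n.\<close>
  define z :: complex where "z = of_real (1 / (2 * M))"
  have "summable (\<lambda>n. oscillator_coeff (fps_nth H) a b n * z ^ n)"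
  proof (rule summable_comparison_test')
    show "summable (\<lambda>n. A * (1/2) ^ n)" by (intro summable_mult summable_geometric) simp
    fix n
    have "norm (oscillator_coeff (fps_nth H) a b n * z ^ n) \<le> A * M ^ n * (1 / (2 * M)) ^ n"
      unfolding norm_mult norm_power z_def norm_of_real
      using M le[of n] order_trans[OF norm_ge_zero le[of n]] by (intro mult_mono power_mono) auto
    also have "\<dots> = A * (1/2) ^ n"
      using M by (simp add: power_divide power_mult_distrib)
    finally show "norm (oscillator_coeff (fps_nth H) a b n * z ^ n) \<le> A * (1/2) ^ n" .
  qed
  then have "ereal (norm z) \<le> fps_conv_radius (Abs_fps (oscillator_coeff (fps_nth H) a b))"
    unfolding fps_conv_radius_def by (auto intro: conv_radius_geI)
  moreover have "0 < norm z" using M by (simp add: z_def)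
  ultimately show ?thesis by (metis ereal_less(2) less_le_trans)
qed

text \<open>The formal series solves the equation formally, and its positive radius of convergence
  makes it a genuine solution near \<open>z0\<close>. Keeping the derivative as a second function
  \<open>v\<close> turns the equation into a first-order system with free initial values.\<close>

lemma oscillator_equation_local_solution:
  fixes h :: "complex \<Rightarrow> complex"
  assumes "open S" "h holomorphic_on S" "z0 \<in> S"
  obtains r u v where "0 < r" "u z0 = a" "v z0 = b"
    "\<And>z. z \<in> ball z0 r \<Longrightarrow> (u has_field_derivative v z) (at z)"
    "\<And>z. z \<in> ball z0 r \<Longrightarrow> (v has_field_derivative - h z * u z) (at z)"
proof -
  define g where "g = (\<lambda>w. h (z0 + w))"
  have "g holomorphic_on ((+) (-z0) ` S)"
    unfolding g_def using assms(2)
    by (intro holomorphic_on_compose_gen[of "\<lambda>w. z0 + w" _ h S, unfolded o_def] holomorphic_intros) auto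
  moreover have "open ((+) (-z0) ` S)" by (rule open_translation[OF assms(1)])
  moreover have "0 \<in> (+) (-z0) ` S"
    using assms(3) by (auto simp: image_iff)
  ultimately have "g has_fps_expansion fps_expansion g 0" by blast
  then obtain H where H: "fps_conv_radius H > 0" "eventually (\<lambda>w. eval_fps H w = g w) (nhds 0)"
    unfolding has_fps_expansion_def by blast
  then obtain d where d: "d > 0" "\<And>w. norm w < d \<Longrightarrow> eval_fps H w = g w"
    by (auto simp: eventually_nhds_metric dist_norm)
  define P where "P = Abs_fps (oscillator_coeff (fps_nth H) a b)"
  have P: "fps_conv_radius P > 0"
    unfolding P_def using H(1) by (rule fps_conv_radius_oscillator_pos)
  have PP: "fps_deriv (fps_deriv P) = - (H * P)"
    unfolding P_def by (rule fps_deriv_deriv_oscillator)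
  \<comment> \<open>Below \<open>d\<close> the series \<open>H\<close> sums to the translate of
    \<open>h\<close>. The other two radii permit differentiating \<open>P\<close> termwise and
    evaluating the product \<open>H * P\<close>.\<close>
  obtain r where r: "0 < ereal r" "ereal r < min d (min (fps_conv_radius P) (fps_conv_radius H))"
    using P H(1) d(1) ereal_dense2[of 0 "min d (min (fps_conv_radius P) (fps_conv_radius H))"]
    by auto
  define u where "u = (\<lambda>z. eval_fps P (z - z0))"
  define v where "v = (\<lambda>z. eval_fps (fps_deriv P) (z - z0))"
  have small: "norm (z - z0) < fps_conv_radius P" "norm (z - z0) < fps_conv_radius H"
      "norm (z - z0) < d" if "z \<in> ball z0 r" for z
  proof -
    have *: "ereal (norm (z - z0)) < ereal r" using that by (simp add: dist_norm norm_minus_commute)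
    have "ereal r < fps_conv_radius P" "ereal r < fps_conv_radius H" "ereal r < d"
      using r(2) by simp_all
    then show "norm (z - z0) < fps_conv_radius P" "norm (z - z0) < fps_conv_radius H"
      "norm (z - z0) < d"
      using * by (blast intro: order.strict_trans, blast intro: order.strict_trans, simp)
  qed
  have shift: "((\<lambda>z. z - z0) has_field_derivative 1) (at z)" for z
    by (auto intro!: derivative_eq_intros)
  have "(u has_field_derivative v z) (at z)" if "z \<in> ball z0 r" for z
  proof -
    have "(eval_fps P has_field_derivative eval_fps (fps_deriv P) (z - z0)) (at (z - z0))"
      using small(1)[OF that] by (rule has_field_derivative_eval_fps)
    then show ?thesis
      unfolding u_def v_def using DERIV_chain2[OF _ shift] by fastforce
  qed
  moreover have "(v has_field_derivative - h z * u z) (at z)" if "z \<in> ball z0 r" for z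
  proof -
    have "norm (z - z0) < fps_conv_radius (fps_deriv P)"
      using small(1)[OF that] fps_conv_radius_deriv less_le_trans by blast
    then have "(eval_fps (fps_deriv P) has_field_derivative
        eval_fps (fps_deriv (fps_deriv P)) (z - z0)) (at (z - z0))"
      by (rule has_field_derivative_eval_fps)
    moreover have "eval_fps (fps_deriv (fps_deriv P)) (z - z0) = - h z * u z"
    proof -
      have "ereal (norm (z - z0)) < fps_conv_radius (H * P)"
        using small(1,2)[OF that] by (intro less_le_trans[OF _ fps_conv_radius_mult]) simp
      then show ?thesis
        using small[OF that] d(2)[of "z - z0"]
        by (simp add: PP eval_fps_minus eval_fps_mult u_def g_def)
    qed
    ultimately show ?thesis
      unfolding v_def using DERIV_chain2[OF _ shift] by fastforce
  qed
  moreover have "u z0 = a" "v z0 = b"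
    by (simp_all add: u_def v_def P_def eval_fps_at_0)
  moreover have "0 < r" using r by simp
  ultimately show ?thesis by (intro that[of r u v])
qed

text \<open>The equation has no first-order term: differentiating the Wronskian leaves only - h u1
  u2 + h u1 u2, which cancels, and a ball is convex.\<close>

lemma wronskian_constant:
  fixes h :: "complex \<Rightarrow> complex"
  assumes "\<And>z. z \<in> ball z0 r \<Longrightarrow> (u1 has_field_derivative v1 z) (at z)"
    "\<And>z. z \<in> ball z0 r \<Longrightarrow> (v1 has_field_derivative - h z * u1 z) (at z)"
    "\<And>z. z \<in> ball z0 r \<Longrightarrow> (u2 has_field_derivative v2 z) (at z)"
    "\<And>z. z \<in> ball z0 r \<Longrightarrow> (v2 has_field_derivative - h z * u2 z) (at z)"
    and z: "z \<in> ball z0 r"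
  shows "u1 z * v2 z - v1 z * u2 z = u1 z0 * v2 z0 - v1 z0 * u2 z0"
proof -
  have "((\<lambda>z. u1 z * v2 z - v1 z * u2 z) has_field_derivative 0) (at z within ball z0 r)"
    if "z \<in> ball z0 r" for z
    by (rule has_field_derivative_at_within)
      (auto intro!: derivative_eq_intros assms(1-4)[OF that] simp: algebra_simps)
  then obtain k where "\<forall>z\<in>ball z0 r. u1 z * v2 z - v1 z * u2 z = k"
    using has_field_derivative_zero_constant[OF convex_ball, of z0 r
        "\<lambda>z. u1 z * v2 z - v1 z * u2 z"] by blast
  moreover have "z0 \<in> ball z0 r" using z le_less_trans[OF zero_le_dist] by (metis mem_ball centre_in_ball)
  ultimately show ?thesis using z by simp
qed

subsection \<open>Holomorphic maps and parametrisations of the sphere\<close>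

lemma has_derivative_vecI:
  fixes f :: "'a::real_normed_vector \<Rightarrow> 'b::euclidean_space ^ 'n"
  assumes "\<And>i. ((\<lambda>x. f x $ i) has_derivative (\<lambda>v. f' v $ i)) (at x within S)"
  shows "(f has_derivative f') (at x within S)"
proof (subst has_derivative_componentwise_within, rule ballI)
  fix b :: "'b ^ 'n" assume "b \<in> Basis"
  then obtain i c where "b = axis i c" by (auto simp: Basis_vec_def)
  then show "((\<lambda>x. f x \<bullet> b) has_derivative (\<lambda>x. f' x \<bullet> b)) (at x within S)"
    using has_derivative_inner_left[OF assms[of i], of c] by (simp add: inner_axis)
qed

lemma has_derivative_vec_nth:
  assumes "(f has_derivative f') F"
  shows "((\<lambda>x. f x $ i) has_derivative (\<lambda>v. f' v $ i)) F"
  using bounded_linear.has_derivative[OF bounded_linear_vec_nth assms] .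

text \<open>Chain rule along the complex line through \<open>x\<close> in direction
  \<open>k\<close>. It links the Frechet derivatives, with which the calculations are done, to the
  one-variable derivatives in the definitions of Jacobian, Christoffel symbols and
  curvature.\<close>

lemma partial_deriv_eq:
  assumes "(f has_derivative (\<lambda>v. \<Sum>i\<in>UNIV. a $ i * v $ i)) (at x)"
  shows "partial_deriv k f x = a $ k"
proof -
  have "((\<lambda>t. x + axis k t) has_derivative axis k) (at 0)"
  proof (rule has_derivative_vecI)
    show "((\<lambda>t. (x + axis k t) $ i) has_derivative (\<lambda>t. axis k t $ i)) (at 0)" for i
      by (cases "i = k") (auto simp: axis_def intro!: derivative_eq_intros)
  qed
  moreover have "(f has_derivative (\<lambda>v. \<Sum>i\<in>UNIV. a $ i * v $ i)) (at (x + axis k 0))"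
  proof -
    have "x + axis k 0 = x" by (simp add: vec_eq_iff axis_def)
    then show ?thesis using assms by (simp only:)
  qed
  ultimately have "((\<lambda>t. f (x + axis k t)) has_derivative
      (\<lambda>t. \<Sum>i\<in>UNIV. a $ i * axis k t $ i)) (at 0)"
    by (rule has_derivative_compose)
  moreover have "(\<lambda>t. \<Sum>i\<in>UNIV. a $ i * axis k t $ i) = (\<lambda>t. a $ k * t)"
    by (simp add: axis_def if_distrib[of "(*) _"] cong: if_cong)
  ultimately show ?thesis
    unfolding partial_deriv_def by (intro DERIV_imp_deriv) (simp add: has_field_derivative_def)
qed

lemma has_derivative_matrix_nth:
  fixes F :: "complex ^ 'm \<Rightarrow> complex ^ 'n"
  assumes "(F has_derivative (*v) A) (at x)"
  shows "((\<lambda>x. F x $ a) has_derivative (\<lambda>v. \<Sum>i\<in>UNIV. A $ a $ i * v $ i)) (at x)"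
  using has_derivative_vec_nth[OF assms, of a] by (simp add: matrix_vector_mult_def)

lemma jacobian_matrix_eq:
  assumes "(F has_derivative (*v) A) (at x)"
  shows "jacobian_matrix F x = A"
  using partial_deriv_eq[OF has_derivative_matrix_nth[OF assms]]
  by (simp add: jacobian_matrix_def vec_eq_iff)

lemma holo_map_onI:
  assumes "open S" "\<And>x. x \<in> S \<Longrightarrow> (F has_derivative (*v) (A x)) (at x)"
  shows "holo_map_on F S"
  unfolding holo_map_on_def holo_fun_on_def
  using assms has_derivative_matrix_nth by blast

lemma matrix_inv_mult:
  assumes "invertible A"
  shows "A ** matrix_inv A = mat 1" "matrix_inv A ** A = mat 1"
  using someI_ex[OF assms[unfolded invertible_def]] unfolding matrix_inv_def by blast+

text \<open>The real inverse function theorem provides a differentiable local inverse. Its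
  derivative is the inverse of multiplication by a complex matrix, hence again multiplication by a
  complex matrix, and so the inverse is holomorphic.\<close>

lemma holomorphic_inverse_function_theorem:
  fixes f :: "complex ^ 'n \<Rightarrow> complex ^ 'n" and J :: "complex ^ 'n \<Rightarrow> complex ^ 'n ^ 'n"
  assumes "open S" and der: "\<And>x. x \<in> S \<Longrightarrow> (f has_derivative (*v) (J x)) (at x)"
    and contJ: "continuous_on S J" and "x0 \<in> S" and "invertible (J x0)"
  obtains U V g where "open U" "U \<subseteq> S" "x0 \<in> U" "open V" "homeomorphism U V f g" "holo_map_on g V"
proof -
  define f' where "f' x = Blinfun ((*v) (J x))" for x
  have f': "blinfun_apply (f' x) = (*v) (J x)" for x
    unfolding f'_def by (rule bounded_linear_Blinfun_apply) simp
  obtain B where B: "B ** J x0 = mat 1" using assms(5) by (auto simp: invertible_def)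
  have contf': "continuous_on S f'"
  proof (rule continuous_on_blinfun_componentwise)
    fix i :: "complex ^ 'n"
    have "continuous_on S (\<lambda>x. J x $ a $ b)" for a b
      using contJ by (intro continuous_intros)
    then show "continuous_on S (\<lambda>x. f' x i)"
      unfolding f' matrix_vector_mult_def
      by (intro continuous_on_vec_lambda continuous_on_sum continuous_on_mult continuous_on_const)
  qed
  have leftinv: "Blinfun ((*v) B) o\<^sub>L f' x0 = id_blinfun"
    by (rule blinfun_eqI)
      (simp add: f' bounded_linear_Blinfun_apply matrix_vector_mul_assoc B)
  have derf': "(f has_derivative blinfun_apply (f' x)) (at x)" if "x \<in> S" for x
    using der[OF that] by (simp add: f')
  show thesis
  proof (rule inverse_function_theorem[OF \<open>open S\<close> derf' contf' \<open>x0 \<in> S\<close> leftinv, unfolded f'])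
    fix U V g g'
    assume UV: "open U" "U \<subseteq> S" "x0 \<in> U" "open V" "homeomorphism U V f g"
      and g: "\<And>y. y \<in> V \<Longrightarrow> (g has_derivative (g' y)) (at y)"
        "\<And>y. y \<in> V \<Longrightarrow> g' y = inv ((*v) (J (g y)))"
        "\<And>y. y \<in> V \<Longrightarrow> bij ((*v) (J (g y)))"
    have "(g has_derivative (*v) (matrix_inv (J (g y)))) (at y)" if y: "y \<in> V" for y
    proof -
      obtain A where "A ** J (g y) = mat 1"
        using g(3)[OF y] matrix_left_invertible_injective[of "J (g y)"] by (auto simp: bij_def)
      then have "invertible (J (g y))" using invertible_left_inverse by blast
      then have "inv ((*v) (J (g y))) = (*v) (matrix_inv (J (g y)))"
        by (intro inv_equality) (simp_all add: matrix_vector_mul_assoc matrix_inv_mult)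
      then show ?thesis using g(1)[OF y] g(2)[OF y] by simp
    qed
    then have "holo_map_on g V" by (rule holo_map_onI[OF UV(4)])
    then show thesis by (rule that[OF UV])
  qed
qed

section \<open>Parametrised pieces of the complex sphere\<close>

text \<open>Differentiating the equation of the sphere shows that the position vector is orthogonal
  to every tangent vector, for the complex bilinear form.\<close>

lemma sphere_parametrization_tangent:
  fixes F :: "complex ^ 'm \<Rightarrow> complex ^ 'n"
  assumes "open N" "x \<in> N" and der: "(F has_derivative (*v) A) (at x)"
    and sph: "\<And>y. y \<in> N \<Longrightarrow> F y \<in> complex_sphere r"
  shows "(\<Sum>a\<in>UNIV. F x $ a * A $ a $ i) = 0"
proof -
  have "((\<lambda>y. \<Sum>a\<in>UNIV. (F y $ a)\<^sup>2) has_derivative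
      (\<lambda>v. \<Sum>a\<in>UNIV. 2 * (A *v v) $ a * F x $ a)) (at x)"
    by (auto intro!: derivative_eq_intros has_derivative_vec_nth[OF der])
  moreover have "((\<lambda>y. \<Sum>a\<in>UNIV. (F y $ a)\<^sup>2) has_derivative (\<lambda>v. 0)) (at x)"
    using assms by (intro has_derivative_transform_within_open[OF has_derivative_const, of N x "r\<^sup>2"])
      (auto simp: complex_sphere_def)
  ultimately have "(\<lambda>v. \<Sum>a\<in>UNIV. 2 * (A *v v) $ a * F x $ a) = (\<lambda>v. 0)"
    by (rule has_derivative_unique)
  then have "(\<Sum>a\<in>UNIV. 2 * (A *v axis i 1) $ a * F x $ a) = 0" by meson
  then have "2 * (\<Sum>a\<in>UNIV. F x $ a * A $ a $ i) = 0"
    by (simp add: matrix_vector_mult_def axis_def if_distrib[of "(*) _"] sum_distrib_left mult_ac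
        cong: if_cong)
  then show ?thesis by simp
qed

text \<open>The inverse function theorem needs equal dimensions, while \<open>F\<close> maps two
  variables into \<complex>^3. A radial variable is added, the enlarged map is inverted, and the
  inverse is restricted to the sphere. The metric condition is immediate: with the flat ambient
  metric the pullback is the Gram matrix of \<open>J\<close>.\<close>

lemma local_isometry_of_sphere_parametrization:
  fixes F :: "complex ^ 2 \<Rightarrow> complex ^ 3"
  assumes "open N" "p \<in> N" and r: "r \<noteq> 0"
    and der: "\<And>x. x \<in> N \<Longrightarrow> (F has_derivative (*v) (J x)) (at x)"
    and contJ: "continuous_on N J"
    and sph: "\<And>x. x \<in> N \<Longrightarrow> F x \<in> complex_sphere r"
    and G: "\<And>x. x \<in> N \<Longrightarrow> transpose (J x) ** J x = G x"
    and detG: "det (G p) \<noteq> 0"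
  obtains U V F' where "open U" "p \<in> U" "U \<subseteq> N" "openin (top_of_set (complex_sphere r)) V"
    "holo_map_on F U" "holo_map_on_sub F' V" "\<And>x. x \<in> U \<Longrightarrow> F x \<in> V \<and> F' (F x) = x"
    "\<And>y. y \<in> V \<Longrightarrow> F' y \<in> U \<and> F (F' y) = y"
    "\<And>x. x \<in> U \<Longrightarrow> pullback_metric F flat_metric x = G x"
proof -
  define pr :: "complex ^ 3 \<Rightarrow> complex ^ 2" where "pr v = vector [v $ 1, v $ 2]" for v
  define lift :: "complex ^ 2 \<Rightarrow> complex ^ 3" where "lift x = vector [x $ 1, x $ 2, 1]" for x
  have pr_lift [simp]: "pr (lift x) = x" "lift x $ 3 = 1" for x
    by (simp_all add: pr_def lift_def vec_eq_iff forall_2)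
  have dpr: "(pr has_derivative pr) (at v)" for v
  proof (rule has_derivative_vecI)
    show "((\<lambda>x. pr x $ i) has_derivative (\<lambda>v. pr v $ i)) (at v)" for i
      using exhaust_2[of i]
      by (auto simp: pr_def intro!: bounded_linear_imp_has_derivative bounded_linear_vec_nth)
  qed
  have cpr: "continuous_on T pr" for T
    using dpr by (meson has_derivative_continuous continuous_at_imp_continuous_on)
  have clift: "continuous_on T lift" for T
  proof -
    have "continuous_on T (\<lambda>x. (\<chi> i. lift x $ i))"
    proof (rule continuous_on_vec_lambda)
      show "continuous_on T (\<lambda>x. lift x $ i)" for i
        using exhaust_3[of i]
        by (elim disjE; simp add: lift_def continuous_on_component continuous_on_id)
    qed
    then show ?thesis by simp
  qed
  \<comment> \<open>The cone map \<open>(x, t) \<mapsto> t F x\<close> is a local biholomorphism, as its Gram matrix at \<open>t = 1\<close> is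
    \<open>diag (G, r\<^sup>2)\<close>; on the sphere its local inverse has \<open>t = \<plusminus>1\<close>, and \<open>Re t > 0\<close> selects \<open>t = 1\<close>.\<close>
  define \<Phi> where "\<Phi> v = v $ 3 *s F (pr v)" for v
  define K :: "complex ^ 3 \<Rightarrow> complex ^ 3 ^ 3" where
    "K v = (\<chi> a. vector [v $ 3 * J (pr v) $ a $ 1, v $ 3 * J (pr v) $ a $ 2, F (pr v) $ a])" for v
  define N3 where "N3 = pr -` N"
  have N3: "open N3"
    unfolding N3_def using \<open>open N\<close> cpr[of UNIV] by (rule open_vimage)
  have dPhi: "(\<Phi> has_derivative (*v) (K v)) (at v)" if "v \<in> N3" for v
  proof (rule has_derivative_vecI)
    fix a
    have "((\<lambda>v. F (pr v)) has_derivative (\<lambda>w. J (pr v) *v pr w)) (at v)"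
      using that by (intro has_derivative_compose[OF dpr der]) (simp add: N3_def)
    from has_derivative_vec_nth[OF this, of a]
    have "((\<lambda>v. v $ 3 * F (pr v) $ a) has_derivative
        (\<lambda>w. v $ 3 * (J (pr v) *v pr w) $ a + w $ 3 * F (pr v) $ a)) (at v)"
      by (intro has_derivative_mult bounded_linear_imp_has_derivative bounded_linear_vec_nth)
    then show "((\<lambda>v. \<Phi> v $ a) has_derivative (\<lambda>w. (K v *v w) $ a)) (at v)"
      by (simp add: \<Phi>_def K_def matrix_vector_mult_def sum_2 sum_3 pr_def algebra_simps)
  qed
  have cF: "continuous_on N F"
    using der by (meson has_derivative_continuous continuous_at_imp_continuous_on)
  have cK: "continuous_on N3 K"
    unfolding K_def
  proof (rule continuous_on_vec_lambda)
    fix a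
    have J: "continuous_on N3 (\<lambda>v. J (pr v))" and F: "continuous_on N3 (\<lambda>v. F (pr v))"
      by (auto intro!: continuous_on_compose2[OF contJ cpr] continuous_on_compose2[OF cF cpr]
          simp: N3_def)
    let ?k = "\<lambda>v. vector [v $ 3 * J (pr v) $ a $ 1, v $ 3 * J (pr v) $ a $ 2, F (pr v) $ a] :: complex ^ 3"
    have "continuous_on N3 (\<lambda>v. \<chi> i. ?k v $ i)"
    proof (rule continuous_on_vec_lambda)
      show "continuous_on N3 (\<lambda>v. ?k v $ i)" for i
        using exhaust_3[of i] J F
        by (elim disjE; simp add: continuous_on_mult continuous_on_component continuous_on_id)
    qed
    then show "continuous_on N3 ?k" by simp
  qed
  have inv: "invertible (K (lift p))"
  proof -
    have [simp]: "G p $ 2 $ 1 = G p $ 1 $ 2"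
      unfolding G[OF \<open>p \<in> N\<close>, symmetric]
      by (simp add: matrix_matrix_mult_def transpose_def mult.commute)
    have [simp]: "(\<Sum>a\<in>UNIV. F p $ a * J p $ a $ i) = 0" for i
      by (rule sphere_parametrization_tangent[OF \<open>open N\<close> \<open>p \<in> N\<close> der[OF \<open>p \<in> N\<close>] sph])
    then have [simp]: "(\<Sum>a\<in>UNIV. J p $ a $ i * F p $ a) = 0" for i
      by (simp add: mult.commute)
    have [simp]: "(\<Sum>a\<in>UNIV. F p $ a * F p $ a) = r\<^sup>2"
      using sph[OF \<open>p \<in> N\<close>] by (simp add: complex_sphere_def power2_eq_square)
    have [simp]: "(\<Sum>a\<in>UNIV. J p $ a $ i * J p $ a $ j) = G p $ i $ j" for i j
      using G[OF \<open>p \<in> N\<close>] by (auto simp: vec_eq_iff matrix_matrix_mult_def transpose_def)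
    define Q where "Q = transpose (K (lift p)) ** K (lift p)"
    have "Q $ i $ j = (\<Sum>a\<in>UNIV. K (lift p) $ a $ i * K (lift p) $ a $ j)" for i j
      by (simp add: Q_def matrix_matrix_mult_def transpose_def)
    \<comment> \<open>The simp rules above evaluate every entry of \<open>Q\<close>. Since
      \<open>det Q\<close> is the square of the determinant of \<open>K (lift p)\<close>, the latter
      need not be expanded.\<close>
    then have "det Q = r\<^sup>2 * det (G p)"
      by (simp add: det_3 det_2 K_def) (simp add: algebra_simps)
    then have "det (K (lift p)) \<noteq> 0"
      using r detG by (auto simp: Q_def det_mul)
    then show ?thesis by (simp add: invertible_det_nz)
  qed
  have "lift p \<in> N3" using \<open>p \<in> N\<close> by (simp add: N3_def)
  obtain U0 V0 \<Psi> where Psi: "open U0" "U0 \<subseteq> N3" "lift p \<in> U0" "open V0"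
      "homeomorphism U0 V0 \<Phi> \<Psi>" "holo_map_on \<Psi> V0"
    by (rule holomorphic_inverse_function_theorem[OF N3 dPhi cK \<open>lift p \<in> N3\<close> inv])
  have hom: "\<Phi> (\<Psi> y) = y" "\<Psi> y \<in> U0" if "y \<in> V0" for y
    using Psi(5) that by (auto simp: homeomorphism_def)
  have hom': "\<Psi> (\<Phi> v) = v" "\<Phi> v \<in> V0" if "v \<in> U0" for v
    using Psi(5) that by (auto simp: homeomorphism_def)
  have cPsi: "continuous_on V0 \<Psi>" using Psi(5) by (simp add: homeomorphism_def)
  define U where "U = lift -` U0"
  define W where "W = V0 \<inter> \<Psi> -` {v. 0 < Re (v $ 3)}"
  define F' where "F' y = pr (\<Psi> y)" for y
  have U: "open U" unfolding U_def using Psi(1) clift[of UNIV] by (rule open_vimage)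
  have UN: "U \<subseteq> N" using Psi(2) by (auto simp: U_def N3_def)
  have "open {v :: complex ^ 3. 0 < Re (v $ 3)}"
    by (intro open_Collect_less continuous_intros)
  then have W: "open W"
    unfolding W_def using continuous_openin_preimage_gen[OF cPsi Psi(4)]
    by (meson Psi(4) cPsi continuous_open_preimage)
  \<comment> \<open>This is the extension to an open set of \<complex>^3 that
    \<open>holo_map_on_sub\<close> asks for; one extension serves all points of the sphere in
    \<open>W\<close>.\<close>
  have F'_W: "holo_map_on F' W"
    unfolding holo_map_on_def holo_fun_on_def
  proof (intro allI conjI ballI W)
    fix a :: 2 and y assume "y \<in> W"
    then have y: "y \<in> V0" by (simp add: W_def)
    have "(\<lambda>y. F' y $ a) = (\<lambda>y. \<Psi> y $ 1) \<or> (\<lambda>y. F' y $ a) = (\<lambda>y. \<Psi> y $ 2)"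
      using exhaust_2[of a] by (auto simp: F'_def pr_def)
    moreover have "\<exists>c. ((\<lambda>y. \<Psi> y $ b) has_derivative (\<lambda>v. \<Sum>i\<in>UNIV. c $ i * v $ i)) (at y)" for b
      using Psi(6) y unfolding holo_map_on_def holo_fun_on_def by blast
    ultimately show "\<exists>c. ((\<lambda>y. F' y $ a) has_derivative (\<lambda>v. \<Sum>i\<in>UNIV. c $ i * v $ i)) (at y)"
      by (elim disjE ssubst)
  qed
  show ?thesis
  proof
    show "open U" by fact
    show "p \<in> U" using Psi(3) by (simp add: U_def)
    show "U \<subseteq> N" by fact
    show "openin (top_of_set (complex_sphere r)) (complex_sphere r \<inter> W)"
      using W by (rule openin_open_Int)
    show "holo_map_on F U" using UN der by (intro holo_map_onI[OF U]) blast
    show "holo_map_on_sub F' (complex_sphere r \<inter> W)"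
      unfolding holo_map_on_sub_def using F'_W by blast
    show "F x \<in> complex_sphere r \<inter> W \<and> F' (F x) = x" if "x \<in> U" for x
    proof -
      have "\<Phi> (lift x) = F x" by (simp add: \<Phi>_def)
      with hom'[of "lift x"] that have "F x \<in> V0" "\<Psi> (F x) = lift x" by (simp_all add: U_def)
      then show ?thesis using sph UN that by (auto simp: F'_def W_def)
    qed
    show "F' y \<in> U \<and> F (F' y) = y" if "y \<in> complex_sphere r \<inter> W" for y
    proof -
      \<comment> \<open>Both \<open>y\<close> and \<open>F (F' y)\<close> lie on the sphere, and
        \<open>y\<close> is t times the other point; as the equation of the sphere is quadratic and
        r is nonzero, t^2 = 1.\<close>
      define t where "t = \<Psi> y $ 3"
      have y: "y \<in> V0" "0 < Re t" using that by (auto simp: W_def t_def)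
      have tF: "t *s F (F' y) = y" using hom(1)[OF y(1)] by (simp add: \<Phi>_def t_def F'_def)
      have "F' y \<in> N" using hom(2)[OF y(1)] Psi(2) by (auto simp: F'_def N3_def)
      then have "(\<Sum>a\<in>UNIV. (F (F' y) $ a)\<^sup>2) = r\<^sup>2" using sph by (simp add: complex_sphere_def)
      moreover have "(\<Sum>a\<in>UNIV. (t * F (F' y) $ a)\<^sup>2) = r\<^sup>2"
      proof -
        have "t * F (F' y) $ a = y $ a" for a
          using arg_cong[OF tF, of "\<lambda>v. v $ a"] by simp
        then show ?thesis using that by (simp add: complex_sphere_def)
      qed
      ultimately have "t\<^sup>2 * r\<^sup>2 = r\<^sup>2"
        unfolding power_mult_distrib sum_distrib_left[symmetric] by simp
      then have "t = 1 \<or> t = -1" using r by (simp add: power2_eq_1_iff)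
      then have t: "t = 1" using y(2) by auto
      then have "lift (F' y) = \<Psi> y"
        by (simp add: lift_def F'_def pr_def vec_eq_iff forall_3 t_def)
      then show ?thesis using tF t hom(2)[OF y(1)] by (simp add: U_def)
    qed
    show "pullback_metric F flat_metric x = G x" if "x \<in> U" for x
      using that UN G by (auto simp: pullback_metric_def flat_metric_def jacobian_matrix_eq[OF der])
  qed
qed

section \<open>Coordinate calculus in two complex variables\<close>

lemma has_derivative_comp_nth:
  fixes x :: "complex ^ 'n"
  assumes "(f has_field_derivative D) (at (x $ i))"
  shows "((\<lambda>Z. f (Z $ i)) has_derivative (\<lambda>v. D * v $ i)) (at x)"
proof -
  have "((\<lambda>Z. Z $ i) has_derivative (\<lambda>v. v $ i)) (at x)"
    by (intro bounded_linear_imp_has_derivative bounded_linear_vec_nth)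
  from has_derivative_compose[OF this assms[unfolded has_field_derivative_def]] show ?thesis .
qed

lemma matrix_inv_eqI:
  assumes "A ** B = mat 1" "B ** A = mat 1"
  shows "matrix_inv A = B"
proof -
  have "invertible A" using assms by (auto simp: invertible_def)
  then have "matrix_inv A ** (A ** B) = B"
    by (simp add: matrix_mul_assoc matrix_inv_mult)
  then show ?thesis by (simp add: assms)
qed

lemma partial_deriv_2:
  assumes "(f has_derivative (\<lambda>v :: complex ^ 2. A * v $ 1 + B * v $ 2)) (at x)"
  shows "partial_deriv 1 f x = A" "partial_deriv 2 f x = B"
  using partial_deriv_eq[of f "vector [A, B]" x] assms by (simp_all add: sum_2)

lemma holo_fun_on_2I:
  assumes "open S"
    "\<And>x. x \<in> S \<Longrightarrow> \<exists>A B. (f has_derivative (\<lambda>v :: complex ^ 2. A * v $ 1 + B * v $ 2)) (at x)"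
  shows "holo_fun_on f S"
  unfolding holo_fun_on_def
proof (intro conjI ballI)
  fix x assume "x \<in> S"
  then obtain A B where "(f has_derivative (\<lambda>v. A * v $ 1 + B * v $ 2)) (at x)"
    using assms(2) by blast
  then have "(f has_derivative (\<lambda>v. \<Sum>i\<in>UNIV. (vector [A, B] :: complex ^ 2) $ i * v $ i)) (at x)"
    by (simp add: sum_2)
  then show "\<exists>a. (f has_derivative (\<lambda>v. \<Sum>i\<in>UNIV. a $ i * v $ i)) (at x)" by blast
qed fact

subsection \<open>The metric \<open>G\<^sub>h\<close>\<close>

lemma open_H_dom:
  assumes "open \<U>" "h holomorphic_on \<U>"
  shows "open (H_dom \<U> h)"
proof -
  let ?S = "(\<lambda>Z :: complex ^ 2. Z $ 1) -` \<U>"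
  have S: "open ?S" using assms(1) by (rule open_vimage_vec_nth)
  have "continuous_on ?S (\<lambda>Z. h (Z $ 1))"
    by (rule continuous_on_compose2[OF holomorphic_on_imp_continuous_on[OF assms(2)]])
      (auto intro!: continuous_intros)
  \<comment> \<open>The two exclusions X \<noteq> 0 and X^2 \<noteq> h are merged into the
    nonvanishing of one continuous product.\<close>
  then have "continuous_on ?S (\<lambda>Z. Z $ 2 * ((Z $ 2)\<^sup>2 - h (Z $ 1)))"
    by (intro continuous_on_mult continuous_on_diff continuous_on_power continuous_on_component
        continuous_on_id)
  then have "open (?S \<inter> (\<lambda>Z. Z $ 2 * ((Z $ 2)\<^sup>2 - h (Z $ 1))) -` (- {0}))"
    using S by (rule continuous_open_preimage) auto
  also have "?S \<inter> (\<lambda>Z. Z $ 2 * ((Z $ 2)\<^sup>2 - h (Z $ 1))) -` (- {0}) = H_dom \<U> h"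
    by (auto simp: H_dom_def)
  finally show ?thesis .
qed

lemma G_metric_nth [simp]:
  "G_metric h Z $ 1 $ 1 = (h (Z $ 1) - (Z $ 2)\<^sup>2)\<^sup>2 / (Z $ 2)\<^sup>2"
  "G_metric h Z $ 1 $ 2 = 0" "G_metric h Z $ 2 $ 1 = 0" "G_metric h Z $ 2 $ 2 = 1 / (Z $ 2)\<^sup>2"
  by (simp_all add: G_metric_def)

context
  fixes \<U> :: "complex set" and h :: "complex \<Rightarrow> complex"
  assumes \<U>: "open \<U>" and h: "h holomorphic_on \<U>"
begin

lemma has_derivative_h:
  assumes "Z \<in> H_dom \<U> h"
  shows "((\<lambda>Z. h (Z $ 1)) has_derivative (\<lambda>v. deriv h (Z $ 1) * v $ 1)) (at Z)"
  using assms by (intro has_derivative_comp_nth holomorphic_derivI[OF h \<U>]) (simp add: H_dom_def)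

lemma has_derivative_G_metric_1_1:
  assumes "Z \<in> H_dom \<U> h"
  shows "((\<lambda>Z. (h (Z $ 1) - (Z $ 2)\<^sup>2)\<^sup>2 / (Z $ 2)\<^sup>2) has_derivative
    (\<lambda>v. 2 * (h (Z $ 1) - (Z $ 2)\<^sup>2) * deriv h (Z $ 1) / (Z $ 2)\<^sup>2 * v $ 1 +
         (- 4 * (h (Z $ 1) - (Z $ 2)\<^sup>2) / Z $ 2 - 2 * (h (Z $ 1) - (Z $ 2)\<^sup>2)\<^sup>2 / Z $ 2 ^ 3) * v $ 2))
    (at Z)"
proof -
  have X: "Z $ 2 \<noteq> 0" using assms by (simp add: H_dom_def)
  have dX: "((\<lambda>Z. Z $ 2) has_derivative (\<lambda>v. v $ 2)) (at Z)"
    by (intro bounded_linear_imp_has_derivative bounded_linear_vec_nth)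
  \<comment> \<open>The entry is differentiated as the square of a quotient, which keeps the
    denominators small.\<close>
  have "((\<lambda>Z. ((h (Z $ 1) - (Z $ 2)\<^sup>2) / Z $ 2)\<^sup>2) has_derivative
    (\<lambda>v. 2 * (h (Z $ 1) - (Z $ 2)\<^sup>2) * deriv h (Z $ 1) / (Z $ 2)\<^sup>2 * v $ 1 +
         (- 4 * (h (Z $ 1) - (Z $ 2)\<^sup>2) / Z $ 2 - 2 * (h (Z $ 1) - (Z $ 2)\<^sup>2)\<^sup>2 / Z $ 2 ^ 3) * v $ 2))
    (at Z)"
    by (rule derivative_eq_intros dX has_derivative_h[OF assms] X refl)+
      (use X in \<open>auto simp: fun_eq_iff field_simps power2_eq_square power3_eq_cube\<close>)
  then show ?thesis by (simp add: power_divide)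
qed

text \<open>The vanishing z-component is kept as \<open>0 * v $ 1\<close> so that
  \<open>partial_deriv_2\<close> matches literally.\<close>

lemma has_derivative_G_metric_2_2:
  fixes Z :: "complex ^ 2"
  assumes "Z $ 2 \<noteq> 0"
  shows "((\<lambda>Z. 1 / (Z $ 2)\<^sup>2) has_derivative (\<lambda>v. 0 * v $ 1 + (- 2 / Z $ 2 ^ 3) * v $ 2)) (at Z)"
proof -
  have "((\<lambda>z. 1 / z\<^sup>2) has_field_derivative (- 2 / Z $ 2 ^ 3)) (at (Z $ 2))"
    using assms by (auto intro!: derivative_eq_intros simp: field_simps power2_eq_square power3_eq_cube)
  from has_derivative_comp_nth[OF this] show ?thesis by simp
qed

lemma holo_metric_on_G_metric: "holo_metric_on (H_dom \<U> h) (G_metric h)"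
  unfolding holo_metric_on_def
proof (intro conjI ballI allI)
  fix a b :: 2
  note S = open_H_dom[OF \<U> h]
  have "holo_fun_on (\<lambda>x :: complex ^ 2. 0) (H_dom \<U> h)"
    by (rule holo_fun_on_2I[OF S]) (rule exI[of _ 0], rule exI[of _ 0], simp)
  moreover have "holo_fun_on (\<lambda>x. G_metric h x $ 1 $ 1) (H_dom \<U> h)"
    using has_derivative_G_metric_1_1 by (intro holo_fun_on_2I[OF S]) (simp only: G_metric_nth, blast)
  moreover have "holo_fun_on (\<lambda>x. G_metric h x $ 2 $ 2) (H_dom \<U> h)"
  proof (rule holo_fun_on_2I[OF S])
    fix x assume "x \<in> H_dom \<U> h"
    then have "x $ 2 \<noteq> 0" by (simp add: H_dom_def)
    from has_derivative_G_metric_2_2[OF this]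
    show "\<exists>A B. ((\<lambda>x. G_metric h x $ 2 $ 2) has_derivative (\<lambda>v. A * v $ 1 + B * v $ 2)) (at x)"
      unfolding G_metric_nth by blast
  qed
  ultimately show "holo_fun_on (\<lambda>x. G_metric h x $ a $ b) (H_dom \<U> h)"
    using exhaust_2[of a] exhaust_2[of b] by (elim disjE) simp_all
next
  fix Z assume "Z \<in> H_dom \<U> h"
  then show "det (G_metric h Z) \<noteq> 0" by (auto simp: det_2 H_dom_def)
  show "transpose (G_metric h Z) = G_metric h Z"
    by (simp add: vec_eq_iff forall_2 transpose_def)
qed

section \<open>Christoffel symbols and curvature\<close>

text \<open>For a diagonal metric the first two symbols are half the X-derivative of log G_11, and
  the last is half that of log G_22. The list is the one required for R^1_212: the symbol with all
  indices 1 occurs there only multiplied by \<open>christoffel (G_metric h) 1 2 2\<close>, which is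
  0.\<close>

lemma christoffel_G_metric:
  assumes "Z \<in> H_dom \<U> h"
  shows "christoffel (G_metric h) 1 2 1 Z = - 2 * Z $ 2 / (h (Z $ 1) - (Z $ 2)\<^sup>2) - 1 / Z $ 2"
    "christoffel (G_metric h) 1 1 2 Z = - 2 * Z $ 2 / (h (Z $ 1) - (Z $ 2)\<^sup>2) - 1 / Z $ 2"
    "christoffel (G_metric h) 1 2 2 Z = 0" "christoffel (G_metric h) 2 2 1 Z = 0"
    "christoffel (G_metric h) 2 2 2 Z = - 1 / Z $ 2"
proof -
  \<comment> \<open>Treating h - X^2 as an atom \<open>f\<close> makes all denominators monomials,
    which \<open>field_simps\<close> clears.\<close>
  define X f where "X = Z $ 2" and "f = h (Z $ 1) - X\<^sup>2"
  have nz: "X \<noteq> 0" "f \<noteq> 0" using assms by (auto simp: H_dom_def X_def f_def)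
  have f_eq: "h (Z $ 1) - X\<^sup>2 = f" by (simp add: f_def)
  have inv: "matrix_inv (G_metric h Z) = vector [vector [X\<^sup>2 / f\<^sup>2, 0], vector [0, X\<^sup>2]]"
    using nz by (intro matrix_inv_eqI)
      (simp_all add: vec_eq_iff forall_2 matrix_matrix_mult_def sum_2 mat_def f_eq flip: X_def)
  have "((\<lambda>y :: complex ^ 2. 0) has_derivative (\<lambda>v. 0 * v $ 1 + 0 * v $ 2)) (at Z)" by simp
  note pd = partial_deriv_2[OF has_derivative_G_metric_1_1[OF assms]]
    partial_deriv_2[OF has_derivative_G_metric_2_2[OF nz(1)[unfolded X_def]]]
    partial_deriv_2[OF this]
  show "christoffel (G_metric h) 1 2 1 Z = - 2 * Z $ 2 / (h (Z $ 1) - (Z $ 2)\<^sup>2) - 1 / Z $ 2"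
    "christoffel (G_metric h) 1 1 2 Z = - 2 * Z $ 2 / (h (Z $ 1) - (Z $ 2)\<^sup>2) - 1 / Z $ 2"
    "christoffel (G_metric h) 1 2 2 Z = 0" "christoffel (G_metric h) 2 2 1 Z = 0"
    "christoffel (G_metric h) 2 2 2 Z = - 1 / Z $ 2"
    unfolding christoffel_def inv sum_2 vector_2 G_metric_nth pd X_def[symmetric] f_eq
    using nz by (simp_all add: field_simps power2_eq_square power3_eq_cube)
qed

text \<open>As the metric is diagonal, R_1212 = G_11 R^1_212, so the sectional curvature is R^1_212
  / G_22. All terms containing \<open>f\<close> cancel in R^1_212, leaving - 1 / X^2.\<close>

lemma sectional_curvature_G_metric:
  assumes Z: "Z \<in> H_dom \<U> h"
  shows "sectional_curvature (G_metric h) Z = -1"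
proof -
  note S = open_H_dom[OF \<U> h]
  define X f where "X = Z $ 2" and "f = h (Z $ 1) - X\<^sup>2"
  have nz: "X \<noteq> 0" "f \<noteq> 0" using Z by (auto simp: H_dom_def X_def f_def)
  have f_eq: "h (Z $ 1) - X\<^sup>2 = f" by (simp add: f_def)
  have dX: "((\<lambda>Z. Z $ 2) has_derivative (\<lambda>v. v $ 2)) (at Z)"
    by (intro bounded_linear_imp_has_derivative bounded_linear_vec_nth)
  have "((\<lambda>y :: complex ^ 2. 0) has_derivative (\<lambda>v. 0 * v $ 1 + 0 * v $ 2)) (at Z)" by simp
  \<comment> \<open>The closed forms of the symbols hold only on the domain; its openness lets them
    be differentiated at \<open>Z\<close>.\<close>
  then have "(christoffel (G_metric h) 1 2 2 has_derivative (\<lambda>v. 0 * v $ 1 + 0 * v $ 2)) (at Z)"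
    by (rule has_derivative_transform_within_open[OF _ S Z]) (simp add: christoffel_G_metric)
  note d122 = partial_deriv_2(1)[OF this]
  have "((\<lambda>Z. - 2 * Z $ 2 / (h (Z $ 1) - (Z $ 2)\<^sup>2) - 1 / Z $ 2) has_derivative
      (\<lambda>v. (2 * X * deriv h (Z $ 1) / f\<^sup>2) * v $ 1 + (- 2 / f - 4 * X\<^sup>2 / f\<^sup>2 + 1 / X\<^sup>2) * v $ 2)) (at Z)"
    by (rule derivative_eq_intros dX has_derivative_h[OF Z] refl nz[unfolded f_def X_def])+
      (use nz in \<open>simp add: fun_eq_iff f_eq divide_simps flip: X_def,
        simp add: algebra_simps power2_eq_square\<close>)
  then have "(christoffel (G_metric h) 1 2 1 has_derivative
      (\<lambda>v. (2 * X * deriv h (Z $ 1) / f\<^sup>2) * v $ 1 + (- 2 / f - 4 * X\<^sup>2 / f\<^sup>2 + 1 / X\<^sup>2) * v $ 2)) (at Z)"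
    by (rule has_derivative_transform_within_open[OF _ S Z]) (simp add: christoffel_G_metric)
  note d121 = partial_deriv_2(2)[OF this]
  have curv: "curvature (G_metric h) 1 2 1 2 Z = - 1 / X\<^sup>2"
    unfolding curvature_def d121 d122 sum_2 christoffel_G_metric[OF Z] X_def[symmetric] f_eq
    using nz by (simp add: field_simps power2_eq_square)
  show ?thesis
    unfolding sectional_curvature_def curvature_low_def sum_2 G_metric_nth curv X_def[symmetric] f_eq
    using nz by (simp add: field_simps)
qed

section \<open>The explicit local isometry with the sphere\<close>

lemma locally_holo_isometric_G_metric:
  "locally_holo_isometric (H_dom \<U> h) (G_metric h) (complex_sphere \<i> :: (complex ^ 3) set) flat_metric"
  unfolding locally_holo_isometric_def
proof
  fix p assume p: "p \<in> H_dom \<U> h"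
  then have z0: "p $ 1 \<in> \<U>" by (simp add: H_dom_def)
  \<comment> \<open>The initial values (1, 0) and (0, 1) of the two solutions give Wronskian 1 at
    the centre, hence on the whole common ball.\<close>
  obtain r1 u1 v1 where 1: "0 < r1" "u1 (p $ 1) = 1" "v1 (p $ 1) = 0"
    "\<And>z. z \<in> ball (p $ 1) r1 \<Longrightarrow> (u1 has_field_derivative v1 z) (at z)"
    "\<And>z. z \<in> ball (p $ 1) r1 \<Longrightarrow> (v1 has_field_derivative - h z * u1 z) (at z)"
    by (rule oscillator_equation_local_solution[where a = 1 and b = 0, OF \<U> h z0])
      (rule that; assumption)
  obtain r2 u2 v2 where 2: "0 < r2" "u2 (p $ 1) = 0" "v2 (p $ 1) = 1"
    "\<And>z. z \<in> ball (p $ 1) r2 \<Longrightarrow> (u2 has_field_derivative v2 z) (at z)"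
    "\<And>z. z \<in> ball (p $ 1) r2 \<Longrightarrow> (v2 has_field_derivative - h z * u2 z) (at z)"
    by (rule oscillator_equation_local_solution[where a = 0 and b = 1, OF \<U> h z0])
      (rule that; assumption)
  define B where "B = ball (p $ 1) (min r1 r2)"
  have W: "u1 z * v2 z - v1 z * u2 z = 1" if "z \<in> B" for z
    using wronskian_constant[of "p $ 1" "min r1 r2" u1 v1 h u2 v2 z] 1 2 that by (simp add: B_def)
  define N where "N = H_dom \<U> h \<inter> (\<lambda>Z. Z $ 1) -` B"
  have N: "open N" "p \<in> N" "N \<subseteq> H_dom \<U> h"
    using 1(1) 2(1) p open_H_dom[OF \<U> h]
    by (auto simp: N_def B_def intro!: open_Int open_vimage_vec_nth)
  have X: "Z $ 2 \<noteq> 0" if "Z \<in> N" for Z using that by (simp add: N_def H_dom_def)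
  have du1: "((\<lambda>Z. u1 (Z $ 1)) has_derivative (\<lambda>w. v1 (Z $ 1) * w $ 1)) (at Z)"
    and dv1: "((\<lambda>Z. v1 (Z $ 1)) has_derivative (\<lambda>w. - h (Z $ 1) * u1 (Z $ 1) * w $ 1)) (at Z)"
    and du2: "((\<lambda>Z. u2 (Z $ 1)) has_derivative (\<lambda>w. v2 (Z $ 1) * w $ 1)) (at Z)"
    and dv2: "((\<lambda>Z. v2 (Z $ 1)) has_derivative (\<lambda>w. - h (Z $ 1) * u2 (Z $ 1) * w $ 1)) (at Z)"
    if "Z \<in> N" for Z
    using that by (intro has_derivative_comp_nth 1 2; simp add: N_def B_def)+
  \<comment> \<open>\<open>q\<close> polarises \<open>u \<mapsto> u'\<^sup>2/\<XX> + \<XX> u\<^sup>2\<close>; \<open>qz\<close> and \<open>qX\<close> are its partial derivatives.\<close>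
  define q where "q f f' g g' Z = f' (Z $ 1) * g' (Z $ 1) / Z $ 2 + Z $ 2 * f (Z $ 1) * g (Z $ 1)"
    for f f' g g' :: "complex \<Rightarrow> complex" and Z :: "complex ^ 2"
  define qz where "qz f f' g g' Z = (f (Z $ 1) * g' (Z $ 1) + f' (Z $ 1) * g (Z $ 1)) * (Z $ 2 - h (Z $ 1) / Z $ 2)"
    for f f' g g' :: "complex \<Rightarrow> complex" and Z :: "complex ^ 2"
  define qX where "qX f f' g g' Z = f (Z $ 1) * g (Z $ 1) - f' (Z $ 1) * g' (Z $ 1) / (Z $ 2)\<^sup>2"
    for f f' g g' :: "complex \<Rightarrow> complex" and Z :: "complex ^ 2"
  \<comment> \<open>Replacing f'' by - h f and g'' by - h g in the z-derivative of \<open>q\<close>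
    lets it factor: (f g' + f' g) times X - h / X.\<close>
  have dq: "(q f f' g g' has_derivative (\<lambda>w. qz f f' g g' Z * w $ 1 + qX f f' g g' Z * w $ 2)) (at Z)"
    if Z: "Z \<in> N"
      and f: "((\<lambda>Z. f (Z $ 1)) has_derivative (\<lambda>w. f' (Z $ 1) * w $ 1)) (at Z)"
      and f': "((\<lambda>Z. f' (Z $ 1)) has_derivative (\<lambda>w. - h (Z $ 1) * f (Z $ 1) * w $ 1)) (at Z)"
      and g: "((\<lambda>Z. g (Z $ 1)) has_derivative (\<lambda>w. g' (Z $ 1) * w $ 1)) (at Z)"
      and g': "((\<lambda>Z. g' (Z $ 1)) has_derivative (\<lambda>w. - h (Z $ 1) * g (Z $ 1) * w $ 1)) (at Z)"
    for f f' g g' Z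
  proof -
    have dX: "((\<lambda>Z. Z $ 2) has_derivative (\<lambda>v. v $ 2)) (at Z)"
      by (intro bounded_linear_imp_has_derivative bounded_linear_vec_nth)
    show ?thesis
      unfolding q_def[abs_def] qz_def qX_def
      by (rule derivative_eq_intros dX f f' g g' X[OF Z] refl)+
        (use X[OF Z] in \<open>simp add: fun_eq_iff divide_simps, simp add: algebra_simps power2_eq_square\<close>)
  qed
  let ?a = "q u1 v1 u1 v1" and ?b = "q u2 v2 u2 v2" and ?c = "q u1 v1 u2 v2"
  let ?az = "qz u1 v1 u1 v1" and ?bz = "qz u2 v2 u2 v2" and ?cz = "qz u1 v1 u2 v2"
  let ?aX = "qX u1 v1 u1 v1" and ?bX = "qX u2 v2 u2 v2" and ?cX = "qX u1 v1 u2 v2"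
  define F :: "complex ^ 2 \<Rightarrow> complex ^ 3" where
    "F Z = vector [?c Z, \<i> * (?a Z + ?b Z) / 2, (?a Z - ?b Z) / 2]" for Z
  define J :: "complex ^ 2 \<Rightarrow> complex ^ 2 ^ 3" where
    "J Z = vector [vector [?cz Z, ?cX Z],
                   vector [\<i> * (?az Z + ?bz Z) / 2, \<i> * (?aX Z + ?bX Z) / 2],
                   vector [(?az Z - ?bz Z) / 2, (?aX Z - ?bX Z) / 2]]" for Z
  have dF: "(F has_derivative (*v) (J Z)) (at Z)" if Z: "Z \<in> N" for Z
  proof (rule has_derivative_vecI)
    fix i :: 3
    note d = du1[OF Z] dv1[OF Z] du2[OF Z] dv2[OF Z]
    note da = dq[OF Z d(1,2) d(1,2)] and db = dq[OF Z d(3,4) d(3,4)] and dc = dq[OF Z d]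
    have "((\<lambda>Z. \<i> * (?a Z + ?b Z) / 2) has_derivative
        (\<lambda>w. \<i> * (?az Z + ?bz Z) / 2 * w $ 1 + \<i> * (?aX Z + ?bX Z) / 2 * w $ 2)) (at Z)"
      by (rule derivative_eq_intros da db refl)+ (simp_all add: fun_eq_iff field_simps)
    moreover have "((\<lambda>Z. (?a Z - ?b Z) / 2) has_derivative
        (\<lambda>w. (?az Z - ?bz Z) / 2 * w $ 1 + (?aX Z - ?bX Z) / 2 * w $ 2)) (at Z)"
      by (rule derivative_eq_intros da db refl)+ (simp_all add: fun_eq_iff field_simps)
    ultimately show "((\<lambda>Z. F Z $ i) has_derivative (\<lambda>w. (J Z *v w) $ i)) (at Z)"
      using exhaust_3[of i] dc
      by (elim disjE) (simp_all add: F_def J_def matrix_vector_mult_def sum_2)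
  qed
  have cont: "continuous_on N (\<lambda>Z. f (Z $ 1))"
    if "\<And>Z. Z \<in> N \<Longrightarrow> ((\<lambda>Z. f (Z $ 1)) has_derivative D Z) (at Z)" for f :: "complex \<Rightarrow> complex" and D
    using that by (meson has_derivative_continuous continuous_at_imp_continuous_on)
  have cq: "continuous_on N (qz f f' g g')" "continuous_on N (qX f f' g g')"
    if "continuous_on N (\<lambda>Z. f (Z $ 1))" "continuous_on N (\<lambda>Z. f' (Z $ 1))"
      "continuous_on N (\<lambda>Z. g (Z $ 1))" "continuous_on N (\<lambda>Z. g' (Z $ 1))" for f f' g g'
  proof -
    have "continuous_on N (\<lambda>Z. h (Z $ 1))"
      using N(3) by (intro cont[OF has_derivative_h]) blast
    moreover have "continuous_on N (\<lambda>Z :: complex ^ 2. Z $ 2)"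
      by (intro continuous_on_component continuous_on_id)
    ultimately show "continuous_on N (qz f f' g g')" "continuous_on N (qX f f' g g')"
      unfolding qz_def[abs_def] qX_def[abs_def] using that X
      by (auto intro!: continuous_on_add continuous_on_diff continuous_on_mult continuous_on_divide
          continuous_on_power)
  qed
  note cJ = cq[OF cont[OF du1] cont[OF dv1] cont[OF du1] cont[OF dv1]]
    cq[OF cont[OF du2] cont[OF dv2] cont[OF du2] cont[OF dv2]]
    cq[OF cont[OF du1] cont[OF dv1] cont[OF du2] cont[OF dv2]]
  have "continuous_on N (\<lambda>Z. \<chi> i j. J Z $ i $ j)"
  proof (intro continuous_on_vec_lambda)
    fix i :: 3 and j :: 2
    show "continuous_on N (\<lambda>Z. J Z $ i $ j)"
      using exhaust_3[of i] exhaust_2[of j]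
      by (elim disjE; simp add: J_def)
        (intro cJ continuous_on_add continuous_on_diff continuous_on_mult continuous_on_divide
          continuous_on_const; simp)+
  qed
  then have contJ: "continuous_on N J" by simp
  have sph: "F Z \<in> complex_sphere \<i>" if Z: "Z \<in> N" for Z
  proof -
    define x a b a' b' where "x = Z $ 2" "a = u1 (Z $ 1)" "b = u2 (Z $ 1)" "a' = v1 (Z $ 1)" "b' = v2 (Z $ 1)"
    note defs = this[symmetric]
    have x: "x \<noteq> 0" using X[OF Z] unfolding defs .
    have "Z $ 1 \<in> B" using Z by (simp add: N_def)
    from W[OF this] have w: "a * b' - a' * b = 1" unfolding defs .
    \<comment> \<open>Lagrange's identity: the left side is minus the Gram determinant of the
      vectors (a'/sqrt x, a sqrt x) and (b'/sqrt x, b sqrt x), whose determinant is the Wronskian up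
      to sign.\<close>
    have "(?c Z)\<^sup>2 - ?a Z * ?b Z = - (a * b' - a' * b)\<^sup>2"
      unfolding q_def defs using x
      by (simp add: divide_simps) (simp add: algebra_simps power2_eq_square)
    then have "(?c Z)\<^sup>2 - ?a Z * ?b Z = -1" by (simp add: w)
    moreover have "(?c Z)\<^sup>2 + (\<i> * (?a Z + ?b Z) / 2)\<^sup>2 + ((?a Z - ?b Z) / 2)\<^sup>2 = (?c Z)\<^sup>2 - ?a Z * ?b Z"
      by (simp add: power_mult_distrib power_divide) (simp add: power2_eq_square field_simps)
    ultimately show ?thesis by (simp add: complex_sphere_def sum_3 F_def)
  qed
  have gram: "transpose (J Z) ** J Z = G_metric h Z" if Z: "Z \<in> N" for Z
  proof -
    define x a b a' b' k where "x = Z $ 2" "a = u1 (Z $ 1)" "b = u2 (Z $ 1)" "a' = v1 (Z $ 1)"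
      "b' = v2 (Z $ 1)" "k = h (Z $ 1)"
    note defs = this[symmetric]
    have x: "x \<noteq> 0" using X[OF Z] unfolding defs .
    have "Z $ 1 \<in> B" using Z by (simp add: N_def)
    from W[OF this] have w: "a * b' - a' * b = 1" unfolding defs .
    \<comment> \<open>The Euclidean bilinear form, in the coordinates (c, \<i> (a + b)/2, (a -
      b)/2), is the polar form of c^2 - a b. The three identities below are written in the shape of
      the right side, repeated summands included, so that the Gram entries rewrite to them.\<close>
    have polar: "c1 * c2 + \<i> * (a1 + b1) / 2 * (\<i> * (a2 + b2) / 2) + (a1 - b1) / 2 * ((a2 - b2) / 2) =
        c1 * c2 - (a1 * b2 + a2 * b1) / 2" for a1 a2 b1 b2 c1 c2 :: complex
      by (simp add: field_simps)
    define s where "s = x - k / x"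
    \<comment> \<open>All z-derivatives share the factor \<open>s\<close>; what remains is (a b' +
      a' b)^2 - 4 a a' b b', the square of the Wronskian.\<close>
    have "(?cz Z) * ?cz Z - (?az Z * ?bz Z + ?az Z * ?bz Z) / 2 = (a * b' - a' * b)\<^sup>2 * (x - k / x)\<^sup>2"
      unfolding qz_def defs s_def[symmetric] by (simp add: field_simps power2_eq_square)
    also have "\<dots> = (k - x\<^sup>2)\<^sup>2 / x\<^sup>2"
      unfolding w using x by (simp add: field_simps power2_eq_square)
    finally have zz: "(?cz Z) * ?cz Z - (?az Z * ?bz Z + ?az Z * ?bz Z) / 2 = (k - x\<^sup>2)\<^sup>2 / x\<^sup>2" .
    \<comment> \<open>The mixed entry vanishes identically in a, b, a', b'; the Wronskian enters
      only through the diagonal entries.\<close>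
    have zX: "?cz Z * ?cX Z - (?az Z * ?bX Z + ?aX Z * ?bz Z) / 2 = 0"
      unfolding qz_def qX_def defs s_def[symmetric] using x
      by (simp add: divide_simps) (simp add: algebra_simps power2_eq_square)
    have "?cX Z * ?cX Z - (?aX Z * ?bX Z + ?aX Z * ?bX Z) / 2 = (a * b' - a' * b)\<^sup>2 / x\<^sup>2"
      unfolding qX_def defs using x
      by (simp add: divide_simps) (simp add: algebra_simps power2_eq_square power4_eq_xxxx)
    then have XX: "?cX Z * ?cX Z - (?aX Z * ?bX Z + ?aX Z * ?bX Z) / 2 = 1 / x\<^sup>2"
      by (simp add: w)
    have "(transpose (J Z) ** J Z) $ 1 $ 1 = (k - x\<^sup>2)\<^sup>2 / x\<^sup>2"
      unfolding zz[symmetric] polar[symmetric]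
      by (simp add: matrix_matrix_mult_def transpose_def sum_3 J_def)
    moreover have "(transpose (J Z) ** J Z) $ 1 $ 2 = 0"
      unfolding zX[symmetric] polar[symmetric]
      by (simp add: matrix_matrix_mult_def transpose_def sum_3 J_def)
    moreover have "(transpose (J Z) ** J Z) $ 2 $ 1 = (transpose (J Z) ** J Z) $ 1 $ 2"
      by (simp add: matrix_matrix_mult_def transpose_def mult.commute)
    moreover have "(transpose (J Z) ** J Z) $ 2 $ 2 = 1 / x\<^sup>2"
      unfolding XX[symmetric] polar[symmetric]
      by (simp add: matrix_matrix_mult_def transpose_def sum_3 J_def)
    ultimately show ?thesis by (simp add: vec_eq_iff forall_2 defs)
  qed
  have det: "det (G_metric h p) \<noteq> 0"
    using holo_metric_on_G_metric p by (simp add: holo_metric_on_def)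
  show "\<exists>U V F F'. open U \<and> p \<in> U \<and> U \<subseteq> H_dom \<U> h \<and>
      openin (top_of_set (complex_sphere \<i> :: (complex ^ 3) set)) V \<and>
      holo_map_on F U \<and> holo_map_on_sub F' V \<and>
      (\<forall>x\<in>U. F x \<in> V \<and> F' (F x) = x) \<and> (\<forall>y\<in>V. F' y \<in> U \<and> F (F' y) = y) \<and>
      (\<forall>x\<in>U. pullback_metric F flat_metric x = G_metric h x)"
  proof (rule local_isometry_of_sphere_parametrization[OF N(1,2) _ dF contJ sph gram det])
    fix U V F'
    assume "open U" "p \<in> U" "U \<subseteq> N" "openin (top_of_set (complex_sphere \<i>)) V"
      "holo_map_on F U" "holo_map_on_sub F' V" "\<And>x. x \<in> U \<Longrightarrow> F x \<in> V \<and> F' (F x) = x"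
      "\<And>y. y \<in> V \<Longrightarrow> F' y \<in> U \<and> F (F' y) = y"
      "\<And>x. x \<in> U \<Longrightarrow> pullback_metric F flat_metric x = G_metric h x"
    then show ?thesis
      using N(3) by (intro exI[of _ U] exI[of _ V] exI[of _ F] exI[of _ F'] conjI ballI) auto
  qed simp_all
qed

end

theorem lemma5:
  fixes \<U> :: "complex set" and h :: "complex \<Rightarrow> complex"
  assumes "open \<U>" and "h holomorphic_on \<U>"
  shows "holo_metric_on (H_dom \<U> h) (G_metric h) \<and>
         (\<forall>Z\<in>H_dom \<U> h. sectional_curvature (G_metric h) Z = -1) \<and>
         locally_holo_isometric (H_dom \<U> h) (G_metric h)
           (complex_sphere \<i> :: (complex ^ 3) set) flat_metric"
  using holo_metric_on_G_metric[OF assms] sectional_curvature_G_metric[OF assms]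
    locally_holo_isometric_G_metric[OF assms] by blast

end
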